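(* If $E(\lambda)$ is a skew-Hermitian $n\times n$ matrix pencil with $\operatorname{rank}E=r\leq n$, then it can be written as $$E(\lambda)=\mathfrak i(a_1+\lambda b_1)u_1u_1^*+\cdots+\mathfrak i(a_\ell+\lambda b_\ell)u_\ell u_\ell^*+v_1w_1^*+\cdots+v_sw_s^*-w_1v_1^*-\cdots-w_sv_s^*,$$ where $\mathfrak i$ is the imaginary unit, $a_i,b_i\in\mathbb R$ for $i=1,\dots,\ell$, $u_i,v_j,w_j\in\mathbb C[\lambda]^n$, and (i) $\ell+2s=r$; (ii) $\deg u_1=\cdots=\deg u_\ell=0=\deg v_1=\cdots=\deg v_s$ and $\deg w_1,\dots,\deg w_s\leq 1$.
   Context: A matrix pencil $E(\lambda)=A+\lambda B$ with $A,B\in\mathbb C^{n\times n}$ is skew-Hermitian if $A^*=-A$ and $B^*=-B$. Its rank is the normal rank, i.e. the rank as a matrix over the field of rational functions, $\max_{\lambda\in\mathbb C}\operatorname{rank}(A+\lambda B)$. For $v(\lambda)\in\mathbb C[\lambda]^n$, $\deg v$ is the largest degree of the entries of $v$; so $\deg v=0$ means that $v$ is a constant vector in $\mathbb C^n$. For $w(\lambda)=w_0+\lambda w_1$ with $w_0,w_1\in\mathbb C^n$, $w^*$ denotes $w_0^*+\lambda w_1^*$ (conjugate transpose is applied to coefficients only, not to $\lambda$). *)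

theory Defs
  imports "HOL-Analysis.Analysis" "HOL-Computational_Algebra.Computational_Algebra"
begin

definition conj_transpose :: "complex ^ 'n ^ 'm \<Rightarrow> complex ^ 'm ^ 'n" where
  "conj_transpose A = transpose (map_matrix cnj A)"

definition skew_hermitian :: "complex ^ 'n ^ 'n \<Rightarrow> bool" where
  "skew_hermitian A \<longleftrightarrow> conj_transpose A = - A"

text \<open>The indeterminate \<open>\<lambda>\<close> is the polynomial variable: the entries of \<open>A + \<lambda> B\<close> are the
  polynomials \<open>[:A $ i $ j, B $ i $ j:]\<close>, so identities between matrices of type
  \<^typ>\<open>complex poly ^ 'n ^ 'n\<close> are identities in \<open>\<lambda>\<close>.\<close>

definition pencil :: "complex ^ 'n ^ 'm \<Rightarrow> complex ^ 'n ^ 'm \<Rightarrow> complex poly ^ 'n ^ 'm" where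
  "pencil A B = (\<chi> i j. [:A $ i $ j, B $ i $ j:])"

definition skew_hermitian_pencil :: "complex poly ^ 'n ^ 'n \<Rightarrow> bool" where
  "skew_hermitian_pencil E \<longleftrightarrow>
     (\<exists>A B. skew_hermitian A \<and> skew_hermitian B \<and> E = pencil A B)"

text \<open>Normal rank: the rank over the field of rational functions, the fraction field of
  \<^typ>\<open>complex poly\<close>.\<close>

definition normal_rank :: "complex poly ^ 'n ^ 'm \<Rightarrow> nat" where
  "normal_rank E = rank (map_matrix to_fract E)"

text \<open>Largest degree of an entry.  Since \<^term>\<open>degree 0 = (0::nat)\<close>, degree \<open>0\<close> means exactly
  that the vector is constant, the zero vector included.\<close>

definition vec_degree :: "complex poly ^ 'n \<Rightarrow> nat" where
  "vec_degree v = Max (range (\<lambda>i. degree (v $ i)))"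

text \<open>\<open>v w\<^sup>*\<close>, where \<open>w\<^sup>*\<close> is the row vector obtained by conjugating the coefficients of \<open>w\<close>
  but not the indeterminate.\<close>

definition outer_conj :: "complex poly ^ 'm \<Rightarrow> complex poly ^ 'n \<Rightarrow> complex poly ^ 'n ^ 'm" where
  "outer_conj v w = (\<chi> i j. v $ i * map_poly cnj (w $ j))"

definition poly_scale_matrix :: "complex poly \<Rightarrow> complex poly ^ 'n ^ 'm \<Rightarrow> complex poly ^ 'n ^ 'm" where
  "poly_scale_matrix p M = map_matrix (\<lambda>q. p * q) M"

end

theory Submission
  imports Defs
begin

text \<open>
  The decomposition is built by splitting off one or two ranks at a time, with an
  eigenvector of the pencil \<open>E = A + \<lambda> B\<close>, possibly at infinity, deciding which.

  As long as \<open>E \<noteq> 0\<close> there are constant vectors \<open>x\<close> and \<open>v \<noteq> 0\<close> with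
  \<open>A x = \<alpha> v\<close>, \<open>B x = \<beta> v\<close> and \<open>v\<close> one of \<open>A x\<close>, \<open>B x\<close>
  (\<open>skew_hermitian_pair_eigenvector\<close>), that is, \<open>E x = (\<alpha> + \<lambda> \<beta>) v\<close>. This asks only for one
  vector at which the two images are parallel, so it holds for singular pencils too: either some
  \<open>x\<close> is killed by \<open>B\<close> and not by \<open>A\<close>, or the kernel of \<open>B\<close> lies in that of \<open>A\<close>; in the
  latter case the range of \<open>A\<close> lies in the range of \<open>B\<close>, since both are skew-Hermitian, and
  the map \<open>B x \<mapsto> A x\<close>, an endomorphism of the range of \<open>B\<close>, has an eigenvector.

  Put \<open>t = v\<^sup>* x\<close>. Because \<open>v\<close> is an image of \<open>x\<close> under a skew-Hermitian matrix, \<open>t\<close> is purely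
  imaginary.

  If \<open>t \<noteq> 0\<close>, then \<open>\<alpha>\<close> and \<open>\<beta>\<close> are real, and subtracting
  \<open>t\<^sup>-\<^sup>1 (\<alpha> + \<lambda> \<beta>) v v\<^sup>*\<close>, which has the form \<open>\<i> (a + \<lambda> b) v v\<^sup>*\<close>, lowers the rank
  by one (\<open>rank_one_deflation\<close>).

  If \<open>t = 0\<close>, choose a constant \<open>z\<close> with \<open>v\<^sup>* z = 1\<close> and restrict the form \<open>E\<close> to the
  hyperplane \<open>v\<^sup>* y = 0\<close>, that is, pass to \<open>P\<^sup>* E P\<close> with \<open>P = 1 - z v\<^sup>*\<close>. This subtracts a term
  \<open>v w\<^sup>* - w v\<^sup>*\<close> with \<open>w\<close> of degree at most \<open>1\<close>. Over the field of rational functions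
  the hyperplane contains the kernel of \<open>E\<close>, and it contains \<open>x\<close>, which joins the radical
  of the restricted form because \<open>E x\<close> is a multiple of \<open>v\<close>. The space thus loses one dimension,
  while the radical gains one, and the rank drops by two
  (\<open>rank_two_deflation\<close>).

  In both cases the remainder is again a skew-Hermitian pencil, and induction on the normal rank gives
  \<open>l + 2 s \<le> r\<close>. Terms with \<open>a = b = 0\<close> make up the difference.
\<close>

section \<open>Outer products and rank-reducing factors\<close>

\<comment> \<open>Formal power series use the same symbol for their coefficients.\<close>
no_notation fps_nth (infixl "$" 75)

definition outer :: "'a::comm_ring_1 ^ 'm \<Rightarrow> 'a ^ 'n \<Rightarrow> 'a ^ 'n ^ 'm" where
  "outer a b = (\<chi> i j. a $ i * b $ j)"

text \<open>Bilinear, without conjugation: it serves both the field of rational functions, where no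
  conjugation is at hand, and the Hermitian form, where the left argument is conjugated explicitly.\<close>

definition dotp :: "'a::comm_ring_1 ^ 'n \<Rightarrow> 'a ^ 'n \<Rightarrow> 'a" where
  "dotp a b = (\<Sum>i\<in>UNIV. a $ i * b $ i)"

lemma matrix_mul_outer: "M ** outer a b = outer (M *v a) b"
  by (simp add: vec_eq_iff outer_def matrix_matrix_mult_def matrix_vector_mult_def
      sum_distrib_right mult.assoc)

lemma outer_mul_matrix: "outer a b ** M = outer a (b v* M)"
  by (simp add: vec_eq_iff outer_def matrix_matrix_mult_def vector_matrix_mult_def
      sum_distrib_left mult_ac)

lemma outer_mul_vector: "outer a b *v x = dotp b x *s a"
  by (simp add: vec_eq_iff outer_def dotp_def matrix_vector_mult_def
      sum_distrib_left mult_ac)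

lemma dotp_matrix: "dotp a (M *v b) = dotp (a v* M) b"
  unfolding dotp_def matrix_vector_mult_def vector_matrix_mult_def
  by (simp add: sum_distrib_left sum_distrib_right mult_ac) (rule sum.swap)

lemma dotp_scale: "dotp a (c *s b) = c * dotp a b"
  by (simp add: dotp_def sum_distrib_left mult_ac)

lemma matrix_diff_ldistrib: "A ** (B - C) = A ** B - A ** (C :: 'a::comm_ring_1 ^ 'n ^ 'k)"
  by (simp add: vec_eq_iff matrix_matrix_mult_def right_diff_distrib sum_subtractf)

lemma matrix_diff_rdistrib: "(A - B) ** C = A ** C - B ** (C :: 'a::comm_ring_1 ^ 'n ^ 'k)"
  by (simp add: vec_eq_iff matrix_matrix_mult_def left_diff_distrib sum_subtractf)

text \<open>Every row of \<open>C ** M\<close> is a combination of rows of \<open>M\<close>. A vector that is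
  annihilated by all of the former but not by all of the latter separates the two row spaces, so the
  inclusion is strict.\<close>

lemma rank_left_mult_less:
  fixes M :: "'a::field ^ 'n ^ 'm" and C :: "'a ^ 'm ^ 'k"
  assumes "M *v x \<noteq> 0" and "(C ** M) *v x = 0"
  shows "rank (C ** M) < rank M"
proof -
  let ?K = "{q. dotp q x = 0}"
  have K: "vec.subspace ?K"
    by (auto simp: vec.subspace_def dotp_def sum.distrib distrib_right mult.assoc
        simp flip: sum_distrib_left)
  have "row i (C ** M) \<in> vec.span (rows M)" for i
  proof -
    have "row i (C ** M) = (\<Sum>k\<in>UNIV. C $ i $ k *s row k M)"
      by (simp add: vec_eq_iff row_def matrix_matrix_mult_def)
    also have "\<dots> \<in> vec.span (rows M)"
      by (intro vec.span_sum vec.span_scale vec.span_base) (auto simp: rows_def)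
    finally show ?thesis .
  qed
  then have sub: "rows (C ** M) \<subseteq> vec.span (rows M)"
    by (auto simp: rows_def)
  have row_dot: "dotp (row i N) x = (N *v x) $ i" for i and N :: "'a ^ 'n ^ 'l"
    by (simp add: dotp_def row_def matrix_vector_mult_def)
  have "rows (C ** M) \<subseteq> ?K"
    using assms(2) by (auto simp: rows_def row_dot)
  then have inK: "vec.span (rows (C ** M)) \<subseteq> ?K"
    by (intro vec.span_minimal K)
  from assms(1) obtain i where "(M *v x) $ i \<noteq> 0"
    by (auto simp: vec_eq_iff)
  then have "row i M \<notin> vec.span (rows (C ** M))"
    using inK row_dot[of i M] by auto
  moreover have "row i M \<in> vec.span (rows M)"
    by (intro vec.span_base) (auto simp: rows_def)
  moreover have "vec.span (rows (C ** M)) \<subseteq> vec.span (rows M)"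
    using sub by (intro vec.span_minimal) auto
  ultimately have "vec.span (rows (C ** M)) \<subset> vec.span (rows M)"
    by blast
  then show ?thesis
    unfolding row_rank_def_gen by (intro vec.dim_psubset) auto
qed

text \<open>If \<open>p\<close> lies in the row space of \<open>M\<close> and \<open>p z = 1\<close>, then the factor \<open>1 - z p\<close> can be
  moved to the left of \<open>M\<close>, because \<open>M z p\<close> is then also a matrix times \<open>M\<close>. The vector
  separating the row spaces is \<open>z\<close>.\<close>

lemma rank_right_deflate_less:
  fixes M :: "'a::field ^ 'n ^ 'm"
  assumes g: "g v* M = c *s p" and c: "c \<noteq> 0" and pz: "dotp p z = 1"
  shows "rank (M ** (mat 1 - outer z p)) < rank M"
proof -
  define C where "C = mat 1 - outer (M *v z) ((1/c) *s g)"
  have eq: "M ** (mat 1 - outer z p) = C ** M"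
  proof -
    have "((1/c) *s g) v* M = p"
      using g c by (simp add: scalar_vector_matrix_assoc)
    then show ?thesis
      by (simp add: C_def matrix_diff_ldistrib matrix_diff_rdistrib matrix_mul_outer outer_mul_matrix)
  qed
  have "dotp g (M *v z) = c"
    using pz by (simp add: dotp_matrix g) (simp add: dotp_def mult.assoc flip: sum_distrib_left)
  then have "M *v z \<noteq> 0"
    using c by (auto simp: dotp_def)
  moreover have "(M ** (mat 1 - outer z p)) *v z = 0"
    using pz by (simp add: matrix_vector_mul_assoc [symmetric] matrix_vector_mult_diff_rdistrib outer_mul_vector)
  ultimately show ?thesis
    using rank_left_mult_less eq by metis
qed

text \<open>The mirror image of the previous lemma, with \<open>v\<close> in the column space; here \<open>x\<close> separates
  the row spaces.\<close>

lemma rank_left_deflate_less: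
  fixes M :: "'a::field ^ 'n ^ 'm"
  assumes "M *v x = c *s v" and "c \<noteq> 0" and "dotp g v = 1"
  shows "rank ((mat 1 - outer v g) ** M) < rank M"
proof (rule rank_left_mult_less)
  show "M *v x \<noteq> 0"
    using assms by (auto simp: dotp_def)
  have "dotp g (c *s v) = c"
    using assms(3) by (simp add: dotp_scale)
  then show "((mat 1 - outer v g) ** M) *v x = 0"
    using assms(1)
    by (simp add: matrix_vector_mul_assoc [symmetric] matrix_vector_mult_diff_rdistrib outer_mul_vector)
qed

section \<open>A common eigenvector of a pair of skew-Hermitian matrices\<close>

text \<open>The conjugation is a parameter, so that complex vectors and vectors of polynomials, the latter
  conjugated coefficientwise, share the lemmas on skew-Hermitian matrices.\<close>

definition conj_vec :: "('a \<Rightarrow> 'a) \<Rightarrow> 'a ^ 'n \<Rightarrow> 'a ^ 'n" where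
  "conj_vec \<sigma> x = (\<chi> i. \<sigma> (x $ i))"

lemma skew_adjoint:
  fixes \<sigma> :: "'a::comm_ring_1 \<Rightarrow> 'a" and A :: "'a ^ 'n ^ 'n"
  assumes add: "\<And>a b. \<sigma> (a + b) = \<sigma> a + \<sigma> b" and mult: "\<And>a b. \<sigma> (a * b) = \<sigma> a * \<sigma> b"
    and skew: "\<And>i j. \<sigma> (A $ j $ i) = - A $ i $ j"
  shows "conj_vec \<sigma> x v* A = - conj_vec \<sigma> (A *v x)"
proof -
  have "\<sigma> 0 + \<sigma> 0 = \<sigma> 0 + 0"
    using add[of 0 0] by simp
  then have "\<sigma> 0 = 0"
    by (simp only: add_left_cancel)
  then have "\<sigma> (sum f S) = (\<Sum>i\<in>S. \<sigma> (f i))" for f :: "'n \<Rightarrow> 'a" and S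
    by (induction S rule: infinite_finite_induct) (auto simp: add)
  then show ?thesis
    by (simp add: vec_eq_iff conj_vec_def vector_matrix_mult_def matrix_vector_mult_def mult skew
        sum_negf mult.commute)
qed

lemma skew_form:
  fixes \<sigma> :: "'a::comm_ring_1 \<Rightarrow> 'a" and A :: "'a ^ 'n ^ 'n"
  assumes add: "\<And>a b. \<sigma> (a + b) = \<sigma> a + \<sigma> b" and mult: "\<And>a b. \<sigma> (a * b) = \<sigma> a * \<sigma> b"
    and skew: "\<And>i j. \<sigma> (A $ j $ i) = - A $ i $ j"
  shows "dotp (conj_vec \<sigma> x) (A *v y) = - dotp (conj_vec \<sigma> (A *v x)) y"
  using skew_adjoint[OF assms] by (simp add: dotp_matrix) (simp add: dotp_def sum_negf)

lemma skew_hermitian_entry: "skew_hermitian A \<Longrightarrow> cnj (A $ j $ i) = - A $ i $ j"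
  by (simp add: skew_hermitian_def conj_transpose_def vec_eq_iff transpose_def)

lemma inner_eq_Re_dotp: "inner x y = Re (dotp (conj_vec cnj x) y)" for x y :: "complex ^ 'n"
  by (simp add: inner_vec_def inner_complex_def dotp_def conj_vec_def)

lemma skew_hermitian_inner:
  assumes "skew_hermitian A"
  shows "inner x (A *v y) = - inner (A *v x) y"
  using skew_form[of cnj A x y] skew_hermitian_entry[OF assms] by (simp add: inner_eq_Re_dotp)

text \<open>A skew-Hermitian matrix has a range orthogonal to its kernel. Writing \<open>A x = y + z\<close> with
  \<open>y\<close> in the range of \<open>B\<close> and \<open>z\<close> orthogonal to it, \<open>z\<close> lies in the kernel of \<open>B\<close>, hence
  in that of \<open>A\<close>, hence is orthogonal to \<open>A x\<close>, and so vanishes. The real inner product of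
  \<open>\<complex>\<^sup>n\<close> is enough for this.\<close>

lemma skew_hermitian_range_subset:
  fixes A B :: "complex ^ 'n ^ 'n"
  assumes A: "skew_hermitian A" and B: "skew_hermitian B"
    and ker: "\<And>x. B *v x = 0 \<Longrightarrow> A *v x = 0"
  shows "\<exists>y. B *v y = A *v x"
proof -
  let ?S = "range ((*v) B)"
  have lin: "linear ((*v) B)"
    by (auto intro!: linearI simp: matrix_vector_right_distrib vec_eq_iff matrix_vector_mult_def
        scaleR_sum_right)
  have S: "span ?S = ?S"
    using linear_subspace_image[OF lin subspace_UNIV] by (simp add: span_eq_iff)
  obtain y z where y: "y \<in> span ?S" and z: "\<And>w. w \<in> span ?S \<Longrightarrow> orthogonal z w"
    and x: "A *v x = y + z"
    using orthogonal_subspace_decomp_exists by metis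
  have z: "inner z (B *v w) = 0" for w
    using z S by (auto simp: orthogonal_def)
  have "inner (B *v z) (B *v z) = 0"
    using z[of "B *v z"] skew_hermitian_inner[OF B, of z "B *v z"] by simp
  then have "A *v z = 0"
    using ker by simp
  then have "inner z (A *v x) = 0"
    using skew_hermitian_inner[OF A, of z x] by simp
  moreover have "inner z y = 0"
    using y z S by auto
  ultimately have "z = 0"
    by (simp add: x inner_add_right)
  then show ?thesis
    using x y S by auto
qed

text \<open>A linear dependency among the first \<open>n + 1\<close> vectors, with its coefficients bundled into a
  polynomial so that a root can be split off, as one does with a minimal polynomial.\<close>

lemma polynomial_relation_exists:
  fixes Y :: "nat \<Rightarrow> 'a::field ^ 'n"
  shows "\<exists>p. p \<noteq> 0 \<and> (\<Sum>k\<le>degree p. coeff p k *s Y k) = 0"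
proof -
  let ?N = "CARD('n)"
  have "\<exists>c. (\<exists>k\<le>?N. c k \<noteq> 0) \<and> (\<Sum>k\<le>?N. c k *s Y k) = 0"
    \<comment> \<open>Dependence is a property of the set of values; if a value is repeated, that is itself a relation.\<close>
  proof (cases "inj_on Y {..?N}")
    case True
    have "card (Y ` {..?N}) > vec.dim (Y ` {..?N})"
      using dim_subset_UNIV_cart_gen[of "Y ` {..?N}"] True by (simp add: card_image)
    then have "vec.dependent (Y ` {..?N})"
      using vec.dim_eq_card_independent by fastforce
    then obtain u where u: "\<exists>v\<in>Y ` {..?N}. u v \<noteq> 0" "(\<Sum>v\<in>Y ` {..?N}. u v *s v) = 0"
      by (auto simp: vec.dependent_finite)
    show ?thesis
      using u True by (intro exI[of _ "u \<circ> Y"]) (auto simp: sum.reindex)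
  next
    case False
    then obtain i j where ij: "i \<le> ?N" "j \<le> ?N" "i \<noteq> j" "Y i = Y j"
      by (auto simp: inj_on_def)
    have "(\<Sum>k\<le>?N. (if k = i then 1 else if k = j then - 1 else 0) *s Y k)
        = (\<Sum>k\<le>?N. (if k = i then Y i else 0) - (if k = j then Y j else 0))"
      using ij by (intro sum.cong) auto
    also have "\<dots> = 0"
      using ij by (simp add: sum_subtractf)
    finally show ?thesis
      using ij by (intro exI[of _ "\<lambda>k. if k = i then 1 else if k = j then - 1 else 0"]) auto
  qed
  then obtain c k where c: "k \<le> ?N" "c k \<noteq> 0" "(\<Sum>k\<le>?N. c k *s Y k) = 0"
    by blast
  define p where "p = (\<Sum>k\<le>?N. monom (c k) k)"
  have coeff_p: "coeff p k = (if k \<le> ?N then c k else 0)" for k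
    by (auto simp: p_def coeff_sum)
  have "degree p \<le> ?N"
    by (rule degree_le) (simp add: coeff_p)
  then have "(\<Sum>k\<le>degree p. coeff p k *s Y k) = (\<Sum>k\<le>?N. coeff p k *s Y k)"
    by (intro sum.mono_neutral_left) (auto simp: coeff_eq_0)
  also have "\<dots> = 0"
    using c(3) by (simp add: coeff_p)
  finally show ?thesis
    using c coeff_p[of k] by (intro exI[of _ p]) auto
qed

text \<open>Since \<open>B\<close> may be singular, one does not form \<open>A B\<^sup>-\<^sup>1\<close> but follows a chain \<open>X\<close> with
  \<open>B X\<^sub>k\<^sub>+\<^sub>1 = A X\<^sub>k\<close> and \<open>B X\<^sub>0 \<noteq> 0\<close>. The polynomial \<open>p\<close> of least degree with
  \<open>\<Sum> p\<^sub>k B X\<^sub>k = 0\<close> has a root \<open>\<mu>\<close>, and the cofactor \<open>q = p / [:- \<mu>, 1:]\<close> yields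
  \<open>x = \<Sum> q\<^sub>k X\<^sub>k\<close>: minimality gives \<open>B x \<noteq> 0\<close>, and \<open>A x - \<mu> B x\<close> is the vanishing sum for
  \<open>p\<close>.\<close>

lemma eigenvector_of_range_subset:
  fixes A B :: "complex ^ 'n ^ 'n"
  assumes range: "\<And>x. \<exists>y. B *v y = A *v x" and B: "B \<noteq> 0"
  shows "\<exists>\<mu> x. B *v x \<noteq> 0 \<and> A *v x = \<mu> *s (B *v x)"
proof -
  obtain x0 where x0: "B *v x0 \<noteq> 0"
    using B matrix_eq[of B 0] by auto
  obtain s where s: "\<And>x. B *v s x = A *v x"
    using range by metis
  define X where "X k = (s ^^ k) x0" for k
  have X: "X 0 = x0" "B *v X (Suc k) = A *v X k" for k
    by (auto simp: X_def s)
  define rel where "rel p \<longleftrightarrow> p \<noteq> 0 \<and> (\<Sum>k\<le>degree p. coeff p k *s (B *v X k)) = 0" for p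
  obtain p where p: "rel p" and least: "\<And>q. rel q \<Longrightarrow> degree p \<le> degree q"
  proof -
    obtain p where "rel p"
      using polynomial_relation_exists[of "\<lambda>k. B *v X k"] by (auto simp: rel_def)
    then show ?thesis
      using that ex_has_least_nat[of rel p degree] by blast
  qed
  have "degree p \<noteq> 0"
  proof
    assume "degree p = 0"
    then obtain c where "p = [:c:]"
      by (auto elim: degree_eq_zeroE)
    then show False
      using p x0 X(1) by (auto simp: rel_def)
  qed
  then obtain \<mu> where "poly p \<mu> = 0"
    using fundamental_theorem_of_algebra[of p] constant_degree[of p] by auto
  then obtain q where q: "p = [:- \<mu>, 1:] * q"
    by (auto simp: poly_eq_0_iff_dvd elim: dvdE)
  have q0: "q \<noteq> 0"
    using p by (auto simp: q rel_def)
  then have deg: "degree p = Suc (degree q)"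
    unfolding q by (subst degree_mult_eq) auto
  define x where "x = (\<Sum>k\<le>degree q. coeff q k *s X k)"
  have img: "M *v x = (\<Sum>k\<le>degree q. coeff q k *s (M *v X k))" for M :: "complex ^ 'n ^ 'n"
    unfolding x_def
    by (simp add: vec.linear_sum[OF matrix_vector_mul_linear_gen] vec.linear_scale[OF matrix_vector_mul_linear_gen])
  have "B *v x \<noteq> 0"
  proof
    assume "B *v x = 0"
    then have "rel q"
      using q0 by (simp add: rel_def img)
    then show False
      using least deg by fastforce
  qed
  moreover have "A *v x - \<mu> *s (B *v x) = (\<Sum>k\<le>degree p. coeff p k *s (B *v X k))"
  proof -
    let ?Y = "\<lambda>k. B *v X k"
    have "(\<Sum>k\<le>degree p. coeff p k *s ?Y k)
      = (\<Sum>k\<le>degree p. coeff (pCons 0 q) k *s ?Y k) - \<mu> *s (\<Sum>k\<le>degree p. coeff q k *s ?Y k)"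
      by (simp add: q vec.scale_sum_right sum_subtractf algebra_simps)
    also have "(\<Sum>k\<le>degree p. coeff (pCons 0 q) k *s ?Y k) = A *v x"
      unfolding deg sum.atMost_Suc_shift by (simp add: img X)
    also have "(\<Sum>k\<le>degree p. coeff q k *s ?Y k) = B *v x"
      unfolding deg by (simp add: img coeff_eq_0)
    finally show ?thesis
      by simp
  qed
  ultimately show ?thesis
    using p by (intro exI[of _ \<mu>] exI[of _ x]) (auto simp: rel_def)
qed

text \<open>The case \<open>\<beta> = 0\<close> is an eigenvalue at infinity. The last conclusion makes \<open>v\<^sup>* x\<close> purely
  imaginary, and it excludes \<open>\<alpha> = \<beta> = 0\<close>.\<close>

lemma skew_hermitian_pair_eigenvector:
  fixes A B :: "complex ^ 'n ^ 'n"
  assumes A: "skew_hermitian A" and B: "skew_hermitian B" and nz: "A \<noteq> 0 \<or> B \<noteq> 0"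
  obtains x v \<alpha> \<beta> where "v \<noteq> 0" "A *v x = \<alpha> *s v" "B *v x = \<beta> *s v" "v = A *v x \<or> v = B *v x"
proof (cases "\<exists>x. B *v x = 0 \<and> A *v x \<noteq> 0")
  case True
  then obtain x where "B *v x = 0" "A *v x \<noteq> 0"
    by blast
  then show thesis
    by (intro that[of "A *v x" x 1 0]) auto
next
  case False
  then have "B \<noteq> 0"
    using nz matrix_eq[of A 0] by auto
  moreover have "\<exists>y. B *v y = A *v x" for x
    using False skew_hermitian_range_subset[OF A B] by blast
  ultimately obtain \<mu> x where "B *v x \<noteq> 0" "A *v x = \<mu> *s (B *v x)"
    using eigenvector_of_range_subset[of B A] by blast
  then show thesis
    by (intro that[of "B *v x" x \<mu> 1]) auto
qed

section \<open>Deflation of skew-Hermitian pencils\<close>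

abbreviation star :: "complex poly ^ 'n \<Rightarrow> complex poly ^ 'n" where
  "star \<equiv> conj_vec (map_poly cnj)"

definition const_vec :: "complex ^ 'n \<Rightarrow> complex poly ^ 'n" where
  "const_vec x = (\<chi> i. [:x $ i:])"

lemma matrix_vector_mult_scale: "M *v (c *s x) = c *s (M *v x)" for c :: "'a::comm_ring_1"
  by (simp add: vec_eq_iff matrix_vector_mult_def sum_distrib_left mult_ac)

lemma map_poly_cnj_add: "map_poly cnj (p + q) = map_poly cnj p + map_poly cnj q"
  by (rule poly_eqI) (simp add: coeff_map_poly)

lemma map_poly_cnj_mult: "map_poly cnj (p * q) = map_poly cnj p * map_poly cnj q"
  by (rule poly_eqI) (simp add: coeff_map_poly coeff_mult)

lemma map_poly_cnj_uminus: "map_poly cnj (- p) = - map_poly cnj p"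
  by (rule poly_eqI) (simp add: coeff_map_poly)

lemma map_poly_cnj_diff: "map_poly cnj (p - q) = map_poly cnj p - map_poly cnj q"
  by (rule poly_eqI) (simp add: coeff_map_poly)

lemma map_poly_cnj_cnj: "map_poly cnj (map_poly cnj p) = p"
  by (rule poly_eqI) (simp add: coeff_map_poly)

lemma map_poly_cnj_smult: "map_poly cnj (smult c p) = smult (cnj c) (map_poly cnj p)"
  by (rule poly_eqI) (simp add: coeff_map_poly)

lemma map_poly_cnj_sum: "map_poly cnj (sum f S) = (\<Sum>i\<in>S. map_poly cnj (f i))"
  by (induction S rule: infinite_finite_induct) (auto simp: map_poly_cnj_add)

lemmas map_poly_cnj_hom = map_poly_cnj_add map_poly_cnj_mult map_poly_cnj_uminus
  map_poly_cnj_diff map_poly_cnj_smult map_poly_cnj_cnj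

lemma map_poly_cnj_dotp: "map_poly cnj (dotp (star x) y) = dotp (star y) x"
  by (simp add: dotp_def conj_vec_def map_poly_cnj_sum map_poly_cnj_mult map_poly_cnj_cnj mult.commute)

lemma outer_conj_eq_outer: "outer_conj v w = outer v (star w)"
  by (simp add: outer_conj_def outer_def conj_vec_def)

text \<open>This form shows at once that the class of skew-Hermitian pencils is closed under the subtractions
  performed below.\<close>

lemma skew_hermitian_pencil_iff:
  "skew_hermitian_pencil E \<longleftrightarrow>
     (\<forall>i j. degree (E $ i $ j) \<le> 1 \<and> map_poly cnj (E $ j $ i) = - E $ i $ j)"
proof
  assume "skew_hermitian_pencil E"
  then obtain A B where "skew_hermitian A" "skew_hermitian B" "E = pencil A B"
    by (auto simp: skew_hermitian_pencil_def)
  then show "\<forall>i j. degree (E $ i $ j) \<le> 1 \<and> map_poly cnj (E $ j $ i) = - E $ i $ j"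
    by (simp add: pencil_def map_poly_pCons skew_hermitian_entry)
next
  assume E: "\<forall>i j. degree (E $ i $ j) \<le> 1 \<and> map_poly cnj (E $ j $ i) = - E $ i $ j"
  have coeff: "cnj (coeff (E $ j $ i) k) = - coeff (E $ i $ j) k" for i j k
    using E by (metis coeff_map_poly coeff_minus complex_cnj_zero)
  have "skew_hermitian (map_matrix (\<lambda>p. coeff p k) E)" for k
    by (simp add: skew_hermitian_def conj_transpose_def vec_eq_iff transpose_def coeff)
  moreover have "E = pencil (map_matrix (\<lambda>p. coeff p 0) E) (map_matrix (\<lambda>p. coeff p 1) E)"
  proof -
    have "p = [:coeff p 0, coeff p 1:]" if "degree p \<le> 1" for p :: "complex poly"
      using that by (intro poly_eqI) (auto simp: coeff_pCons coeff_eq_0 split: nat.split)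
    then show ?thesis
      using E by (simp add: vec_eq_iff pencil_def)
  qed
  ultimately show "skew_hermitian_pencil E"
    unfolding skew_hermitian_pencil_def by blast
qed

lemma map_matrix_to_fract_mult:
  "map_matrix to_fract (M ** N) = map_matrix to_fract M ** map_matrix to_fract N"
  by (simp add: vec_eq_iff matrix_matrix_mult_def)

lemma map_matrix_to_fract_deflate:
  "map_matrix to_fract (mat 1 - outer a b) =
     mat 1 - outer (\<chi> i. to_fract (a $ i)) (\<chi> i. to_fract (b $ i))"
  by (simp add: vec_eq_iff outer_def mat_def)

lemma normal_rank_right_deflate_less:
  assumes "g v* M = c *s p" and "c \<noteq> 0" and "dotp p z = 1"
  shows "normal_rank (M ** (mat 1 - outer z p)) < normal_rank M"
  unfolding normal_rank_def map_matrix_to_fract_mult map_matrix_to_fract_deflate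
proof (rule rank_right_deflate_less)
  have "to_fract ((g v* M) $ j) = to_fract ((c *s p) $ j)" for j
    by (simp add: assms(1))
  then show "(\<chi> i. to_fract (g $ i)) v* map_matrix to_fract M
      = to_fract c *s (\<chi> i. to_fract (p $ i))"
    by (simp add: vec_eq_iff vector_matrix_mult_def)
  show "to_fract c \<noteq> 0"
    using assms(2) by simp
  show "dotp (\<chi> i. to_fract (p $ i)) (\<chi> i. to_fract (z $ i)) = 1"
    using arg_cong[OF assms(3), of to_fract] by (simp add: dotp_def)
qed

lemma normal_rank_left_deflate_less:
  assumes "M *v x = c *s v" and "c \<noteq> 0" and "dotp g v = 1"
  shows "normal_rank ((mat 1 - outer v g) ** M) < normal_rank M"
  unfolding normal_rank_def map_matrix_to_fract_mult map_matrix_to_fract_deflate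
proof (rule rank_left_deflate_less)
  have "to_fract ((M *v x) $ j) = to_fract ((c *s v) $ j)" for j
    by (simp add: assms(1))
  then show "map_matrix to_fract M *v (\<chi> i. to_fract (x $ i))
      = to_fract c *s (\<chi> i. to_fract (v $ i))"
    by (simp add: vec_eq_iff matrix_vector_mult_def)
  show "to_fract c \<noteq> 0"
    using assms(2) by simp
  show "dotp (\<chi> i. to_fract (g $ i)) (\<chi> i. to_fract (v $ i)) = 1"
    using arg_cong[OF assms(3), of to_fract] by (simp add: dotp_def)
qed

text \<open>The hypothesis \<open>E x = p v\<close> is used twice: directly it puts \<open>v\<close> into the column space of \<open>E\<close>
  over the rational functions, and, conjugated, it puts \<open>v\<^sup>*\<close> into the row space.\<close>

context
  fixes E :: "complex poly ^ 'n ^ 'n" and x v :: "complex poly ^ 'n" and p :: "complex poly"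
  assumes skew: "skew_hermitian_pencil E"
    and Ex: "E *v x = p *s v" and p: "p \<noteq> 0"
begin

lemma star_mult_pencil: "star y v* E = - star (E *v y)"
  using skew by (intro skew_adjoint map_poly_cnj_add map_poly_cnj_mult) (simp add: skew_hermitian_pencil_iff)

lemma star_eigenvector_mult: "star x v* E = (- map_poly cnj p) *s star v"
  unfolding star_mult_pencil Ex by (simp add: vec_eq_iff conj_vec_def map_poly_cnj_mult)

lemma cnj_p_nonzero: "- map_poly cnj p \<noteq> 0"
  using p map_poly_cnj_cnj[of p] by auto

text \<open>With \<open>z = x / t\<close> the product \<open>E (1 - z v\<^sup>*)\<close> is exactly \<open>E - (p / t) v v\<^sup>*\<close>, and
  the second factor lowers the rank because \<open>v\<^sup>*\<close> lies in the row space of \<open>E\<close>.\<close>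

lemma rank_one_deflation:
  assumes t: "dotp (star v) x = [:t:]" "t \<noteq> 0"
  shows "normal_rank (E - outer (smult (1/t) p *s v) (star v)) < normal_rank E"
proof -
  define z where "z = [:1/t:] *s x"
  have "dotp (star v) z = [:1/t:] * dotp (star v) x"
    by (simp only: z_def dotp_scale)
  then have "dotp (star v) z = 1"
    using t by simp
  then have "normal_rank (E ** (mat 1 - outer z (star v))) < normal_rank E"
    using star_eigenvector_mult cnj_p_nonzero by (rule normal_rank_right_deflate_less[rotated 2])
  moreover have "E *v z = smult (1/t) p *s v"
    by (simp add: z_def matrix_vector_mult_scale Ex vec_eq_iff)
  ultimately show ?thesis
    by (simp add: matrix_diff_ldistrib matrix_mul_outer)
qed

text \<open>Both sides are multiplied, giving \<open>(1 - v z\<^sup>*) E (1 - z v\<^sup>*)\<close>. The right factor lowers the rank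
  because \<open>v\<^sup>*\<close> lies in the row space of \<open>E\<close>; it fixes \<open>x\<close>, because \<open>v\<^sup>* x = 0\<close>, so that \<open>v\<close>
  stays in the column space and the left factor lowers the rank again. The vector \<open>w\<close> carries half
  of the term \<open>(z\<^sup>* E z) v v\<^sup>*\<close>; the other half comes from conjugation, as \<open>z\<^sup>* E z\<close> is
  skew.\<close>

lemma rank_two_deflation:
  assumes iso: "dotp (star v) x = 0" and z: "dotp (star v) z = 1"
    and w: "w = [:1/2:] *s (dotp (star z) (E *v z) *s v) - E *v z"
  shows "normal_rank (E - outer_conj v w + outer_conj w v) + 2 \<le> normal_rank E"
proof -
  let ?R = "mat 1 - outer z (star v)" and ?L = "mat 1 - outer v (star z)"
  define k where "k = dotp (star z) (E *v z)"
  have "normal_rank (E ** ?R) < normal_rank E"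
    using star_eigenvector_mult cnj_p_nonzero z by (rule normal_rank_right_deflate_less)
  moreover have "normal_rank (?L ** (E ** ?R)) < normal_rank (E ** ?R)"
  proof (rule normal_rank_left_deflate_less)
    show "(E ** ?R) *v x = p *s v"
      by (simp add: matrix_vector_mul_assoc [symmetric] matrix_vector_mult_diff_rdistrib
          outer_mul_vector iso Ex)
    show "dotp (star z) v = 1"
      using z map_poly_cnj_dotp[of v z] by (simp add: one_pCons map_poly_pCons)
  qed (fact p)
  moreover have "?L ** (E ** ?R) = E - outer_conj v w + outer_conj w v"
  proof -
    have "dotp (star z) (E *v z) = - dotp (star (E *v z)) z"
      by (simp add: dotp_matrix star_mult_pencil) (simp add: dotp_def sum_negf)
    then have k: "map_poly cnj k = - k"
      unfolding k_def map_poly_cnj_dotp by simp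
    have star_w: "star w = - ([:1/2:] *s (k *s star v)) - star (E *v z)"
      unfolding w k_def[symmetric] using k by (simp add: conj_vec_def vec_eq_iff map_poly_cnj_hom map_poly_pCons)
    have "?L ** (E ** ?R) = E + outer v (star (E *v z)) - outer (E *v z) (star v) + outer (k *s v) (star v)"
      by (simp add: matrix_diff_ldistrib matrix_diff_rdistrib matrix_mul_outer outer_mul_matrix
          star_mult_pencil matrix_vector_mult_diff_rdistrib outer_mul_vector)
        (simp add: vec_eq_iff outer_def k_def algebra_simps)
    also have "\<dots> = E - outer_conj v w + outer_conj w v"
    proof -
      \<comment> \<open>Kept opaque, lest the simplifier turn products with it into scalar multiples.\<close>
      define h :: "complex poly" where "h = [:1/2:]"
      have "h + h = 1"
        by (simp add: h_def one_pCons)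
      then have half: "h * a + h * a = a" for a
        by (simp flip: distrib_right)
      have "(E + outer v (star (E *v z)) - outer (E *v z) (star v) + outer (k *s v) (star v)) $ i $ j =
          (E - outer v (star w) + outer w (star v)) $ i $ j" for i j
        unfolding star_w unfolding w k_def[symmetric] h_def[symmetric]
        using half[of "k * v $ i * star v $ j"] by (simp add: outer_def algebra_simps)
      then show ?thesis
        by (simp add: vec_eq_iff outer_conj_eq_outer)
    qed
    finally show ?thesis .
  qed
  ultimately show ?thesis
    by simp
qed

end

section \<open>Sums of rank-one and rank-two terms\<close>

lemma vec_degree_le_iff: "vec_degree v \<le> d \<longleftrightarrow> (\<forall>i. degree (v $ i) \<le> d)"
  by (simp add: vec_degree_def)

text \<open>The number of terms is not tied to the rank of \<open>E\<close>, so that terms can be added freely in the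
  induction and zero terms appended at its end.\<close>

definition decomposes :: "complex poly ^ 'n ^ 'n \<Rightarrow> nat \<Rightarrow> nat \<Rightarrow> bool" where
  "decomposes E l s \<longleftrightarrow> (\<exists>(a :: nat \<Rightarrow> real) (b :: nat \<Rightarrow> real)
      (u :: nat \<Rightarrow> complex poly ^ 'n) (v :: nat \<Rightarrow> complex poly ^ 'n) (w :: nat \<Rightarrow> complex poly ^ 'n).
    E = (\<Sum>i=1..l. poly_scale_matrix [:\<i> * complex_of_real (a i), \<i> * complex_of_real (b i):]
                     (outer_conj (u i) (u i)))
        + (\<Sum>j=1..s. outer_conj (v j) (w j))
        - (\<Sum>j=1..s. outer_conj (w j) (v j)) \<and>
    (\<forall>i\<in>{1..l}. vec_degree (u i) = 0) \<and>
    (\<forall>j\<in>{1..s}. vec_degree (v j) = 0) \<and>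
    (\<forall>j\<in>{1..s}. vec_degree (w j) \<le> 1))"

lemma decomposes_zero: "decomposes 0 0 0"
  by (simp add: decomposes_def)

lemma decomposes_add_rank_one:
  assumes "decomposes E l s" and "vec_degree u = 0"
  shows "decomposes (E + poly_scale_matrix [:\<i> * complex_of_real a, \<i> * complex_of_real b:] (outer_conj u u))
    (Suc l) s"
proof -
  obtain a' b' u' v w where
    "E = (\<Sum>i=1..l. poly_scale_matrix [:\<i> * complex_of_real (a' i), \<i> * complex_of_real (b' i):]
                     (outer_conj (u' i) (u' i)))
        + (\<Sum>j=1..s. outer_conj (v j) (w j))
        - (\<Sum>j=1..s. outer_conj (w j) (v j))"
    "\<forall>i\<in>{1..l}. vec_degree (u' i) = 0"
    "\<forall>j\<in>{1..s}. vec_degree (v j) = 0" "\<forall>j\<in>{1..s}. vec_degree (w j) \<le> 1"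
    using assms(1) unfolding decomposes_def by blast
  moreover have "(\<Sum>i=1..l. poly_scale_matrix [:\<i> * complex_of_real ((a'(Suc l := a)) i),
        \<i> * complex_of_real ((b'(Suc l := b)) i):] (outer_conj ((u'(Suc l := u)) i) ((u'(Suc l := u)) i)))
      = (\<Sum>i=1..l. poly_scale_matrix [:\<i> * complex_of_real (a' i), \<i> * complex_of_real (b' i):]
          (outer_conj (u' i) (u' i)))"
    by (intro sum.cong) simp_all
  ultimately show ?thesis
    unfolding decomposes_def
    by (intro exI[of _ "a'(Suc l := a)"] exI[of _ "b'(Suc l := b)"] exI[of _ "u'(Suc l := u)"]
        exI[of _ v] exI[of _ w] conjI) (simp_all add: assms(2) atLeastAtMostSuc_conv)
qed

lemma decomposes_add_rank_two:
  fixes E :: "complex poly ^ 'n ^ 'n"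
  assumes "decomposes E l s" and "vec_degree v = 0" and "vec_degree w \<le> 1"
  shows "decomposes (E + outer_conj v w - outer_conj w v) l (Suc s)"
proof -
  obtain a b u v' w' where
    "E = (\<Sum>i=1..l. poly_scale_matrix [:\<i> * complex_of_real (a i), \<i> * complex_of_real (b i):]
                     (outer_conj (u i) (u i)))
        + (\<Sum>j=1..s. outer_conj (v' j) (w' j))
        - (\<Sum>j=1..s. outer_conj (w' j) (v' j))"
    "\<forall>i\<in>{1..l}. vec_degree (u i) = 0"
    "\<forall>j\<in>{1..s}. vec_degree (v' j) = 0" "\<forall>j\<in>{1..s}. vec_degree (w' j) \<le> 1"
    using assms(1) unfolding decomposes_def by blast
  note E = this(1) and degrees = this(2-4)
  have extend: "(\<Sum>j=1..Suc s. outer_conj ((f(Suc s := x)) j) ((g(Suc s := y)) j))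
      = (\<Sum>j=1..s. outer_conj (f j) (g j)) + outer_conj x y"
    for f g :: "nat \<Rightarrow> complex poly ^ 'n" and x y
    by (simp add: atLeastAtMostSuc_conv add.commute)
  show ?thesis
    unfolding decomposes_def
  proof (intro exI conjI)
    show "E + outer_conj v w - outer_conj w v =
      (\<Sum>i=1..l. poly_scale_matrix [:\<i> * complex_of_real (a i), \<i> * complex_of_real (b i):]
                     (outer_conj (u i) (u i)))
        + (\<Sum>j=1..Suc s. outer_conj ((v'(Suc s := v)) j) ((w'(Suc s := w)) j))
        - (\<Sum>j=1..Suc s. outer_conj ((w'(Suc s := w)) j) ((v'(Suc s := v)) j))"
      unfolding extend E by (simp only: diff_conv_add_uminus minus_add_distrib ac_simps)
  qed (use degrees assms(2,3) in \<open>simp_all add: atLeastAtMostSuc_conv\<close>)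
qed

lemma decomposes_pad:
  fixes E :: "complex poly ^ 'n ^ 'n"
  assumes "decomposes E l s"
  shows "decomposes E (l + k) s"
proof (induction k)
  case (Suc k)
  have "vec_degree (0 :: complex poly ^ 'n) = 0"
    using vec_degree_le_iff[of "0 :: complex poly ^ 'n" 0] by simp
  moreover have "poly_scale_matrix [:\<i> * complex_of_real 0, \<i> * complex_of_real 0:]
      (outer_conj 0 0) = (0 :: complex poly ^ 'n ^ 'n)"
    by (simp add: vec_eq_iff poly_scale_matrix_def)
  ultimately show ?case
    using decomposes_add_rank_one[OF Suc.IH, of 0 0 0] by simp
qed (use assms in simp)

section \<open>Splitting off a term\<close>

lemma dotp_const_vec:
  fixes x y :: "complex ^ 'n"
  shows "dotp (star (const_vec x)) (const_vec y) = [:dotp (conj_vec cnj x) y:]"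
proof -
  have "(\<Sum>i\<in>S. [:f i:]) = [:sum f S:]" for f :: "'n \<Rightarrow> complex" and S
    by (induction S rule: infinite_finite_induct) auto
  then show ?thesis
    by (simp add: dotp_def conj_vec_def const_vec_def map_poly_pCons mult.commute)
qed

lemma pencil_mult_const_vec:
  fixes x :: "complex ^ 'n"
  assumes "A *v x = \<alpha> *s v" and "B *v x = \<beta> *s v"
  shows "pencil A B *v const_vec x = [:\<alpha>, \<beta>:] *s const_vec v"
proof -
  have "(\<Sum>j\<in>S. [:f j, g j:]) = [:sum f S, sum g S:]" for f g :: "'n \<Rightarrow> complex" and S
    by (induction S rule: infinite_finite_induct) auto
  then show ?thesis
    using assms
    by (simp add: vec_eq_iff matrix_vector_mult_def pencil_def const_vec_def mult.commute)
qed

lemma skew_hermitian_pencil_diff: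
  assumes "skew_hermitian_pencil E" "skew_hermitian_pencil F"
  shows "skew_hermitian_pencil (E - F)"
  using assms by (auto simp: skew_hermitian_pencil_iff map_poly_cnj_diff intro: degree_diff_le)

lemma vec_degree_const_vec: "vec_degree (const_vec v) = 0"
  using vec_degree_le_iff[of "const_vec v" 0] by (simp add: const_vec_def)

lemma degree_matrix_mult_const:
  assumes "\<And>i j. degree (E $ i $ j) \<le> d"
  shows "degree ((E *v const_vec z) $ i) \<le> d"
  unfolding matrix_vector_mult_def const_vec_def
  using assms by (auto intro!: degree_sum_le)

lemma skew_hermitian_pencil_rank_one:
  "skew_hermitian_pencil (poly_scale_matrix [:\<i> * complex_of_real a, \<i> * complex_of_real b:]
    (outer_conj (const_vec v) (const_vec v)))"
  by (simp add: skew_hermitian_pencil_iff poly_scale_matrix_def outer_conj_def const_vec_def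
      map_poly_pCons map_poly_cnj_hom)

lemma skew_hermitian_pencil_rank_two:
  assumes "vec_degree w \<le> 1"
  shows "skew_hermitian_pencil (outer_conj (const_vec v) w - outer_conj w (const_vec v))"
proof -
  have "degree (map_poly cnj (w $ i)) \<le> 1" for i
    using assms by (simp add: vec_degree_le_iff degree_map_poly)
  then show ?thesis
    using assms
    by (auto simp: skew_hermitian_pencil_iff outer_conj_def const_vec_def map_poly_pCons map_poly_cnj_hom
        vec_degree_le_iff intro!: degree_diff_le degree_smult_le[THEN order_trans])
qed

text \<open>Here \<open>x\<^sup>* A x\<close> is purely imaginary and equals \<open>\<alpha>\<close> times the conjugate of \<open>t\<close>, which is
  purely imaginary as well; so \<open>\<alpha>\<close> is real.\<close>

lemma skew_hermitian_eigenvalue_ratio: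
  assumes A: "skew_hermitian A" and Ax: "A *v x = \<alpha> *s v"
    and t: "t = dotp (conj_vec cnj v) x" "t \<noteq> 0" "Re t = 0"
  shows "\<alpha> / t = \<i> * complex_of_real (- Re \<alpha> / Im t)"
proof -
  have "inner (A *v x) x = 0"
    using skew_hermitian_inner[OF A, of x x] by (simp add: inner_commute)
  moreover have "dotp (conj_vec cnj (\<alpha> *s v)) x = cnj \<alpha> * t"
    by (simp add: t(1) dotp_def conj_vec_def sum_distrib_left mult.assoc)
  ultimately have "Im \<alpha> * Im t = 0"
    using t(3) by (simp add: inner_eq_Re_dotp Ax)
  moreover have "Im t \<noteq> 0"
    using t(2,3) by (simp add: complex_eq_iff)
  ultimately have "\<alpha> = complex_of_real (Re \<alpha>)" "t = \<i> * complex_of_real (Im t)" and "Im t \<noteq> 0"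
    using t(3) by (auto simp: complex_eq_iff)
  then have "\<alpha> / t = complex_of_real (Re \<alpha>) / (\<i> * complex_of_real (Im t))"
    by metis
  also have "\<dots> = \<i> * complex_of_real (- Re \<alpha> / Im t)"
    using \<open>Im t \<noteq> 0\<close> by (simp add: divide_simps)
  finally show ?thesis .
qed

text \<open>With \<open>E x = (\<alpha> + \<lambda> \<beta>) v\<close>, the first alternative arises for \<open>v\<^sup>* x \<noteq> 0\<close>, the second for
  \<open>v\<^sup>* x = 0\<close>, by deflating with \<open>z = v / (v\<^sup>* v)\<close>. That \<open>z\<close> is constant keeps the degree of \<open>w\<close> at most \<open>1\<close>.\<close>

lemma skew_hermitian_pencil_reduction:
  assumes skew: "skew_hermitian_pencil E" and nz: "E \<noteq> 0"
  obtains
    (rank_one) a b u F where "vec_degree u = 0" and "skew_hermitian_pencil (E - F)"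
      "normal_rank (E - F) < normal_rank E"
      "F = poly_scale_matrix [:\<i> * complex_of_real a, \<i> * complex_of_real b:] (outer_conj u u)"
  | (rank_two) v w F where "vec_degree v = 0" "vec_degree w \<le> 1" "skew_hermitian_pencil (E - F)"
      "normal_rank (E - F) + 2 \<le> normal_rank E" "F = outer_conj v w - outer_conj w v"
proof -
  obtain A B where A: "skew_hermitian A" and B: "skew_hermitian B" and E: "E = pencil A B"
    using skew by (auto simp: skew_hermitian_pencil_def)
  have "A \<noteq> 0 \<or> B \<noteq> 0"
    using nz by (auto simp: E pencil_def vec_eq_iff)
  then obtain x v \<alpha> \<beta> where v: "v \<noteq> 0" and Ax: "A *v x = \<alpha> *s v" and Bx: "B *v x = \<beta> *s v"
    and v_image: "v = A *v x \<or> v = B *v x"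
    using skew_hermitian_pair_eigenvector[OF A B] by metis
  let ?v = "const_vec v" and ?x = "const_vec x" and ?p = "[:\<alpha>, \<beta>:]"
  define t where "t = dotp (conj_vec cnj v) x"
  have Ex: "E *v ?x = ?p *s ?v"
    unfolding E using Ax Bx by (rule pencil_mult_const_vec)
  have p: "?p \<noteq> 0"
    using v v_image Ax Bx by auto
  have vx: "dotp (star ?v) ?x = [:t:]"
    by (simp add: dotp_const_vec t_def)
  show thesis
  proof (cases "t = 0")
    case False
    have "inner (C *v x) x = 0" if "skew_hermitian C" for C
      using skew_hermitian_inner[OF that, of x x] by (simp add: inner_commute)
    then have "inner v x = 0"
      using v_image A B by auto
    then have "Re t = 0"
      by (simp add: t_def inner_eq_Re_dotp)
    define a b where "a = - Re \<alpha> / Im t" and "b = - Re \<beta> / Im t"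
    have "smult (1/t) ?p = [:\<i> * complex_of_real a, \<i> * complex_of_real b:]"
      using skew_hermitian_eigenvalue_ratio[OF A Ax t_def False \<open>Re t = 0\<close>]
        skew_hermitian_eigenvalue_ratio[OF B Bx t_def False \<open>Re t = 0\<close>]
      by (simp add: a_def b_def)
    then have "outer (smult (1/t) ?p *s ?v) (star ?v) =
        poly_scale_matrix [:\<i> * complex_of_real a, \<i> * complex_of_real b:] (outer_conj ?v ?v)"
      by (simp add: outer_conj_eq_outer poly_scale_matrix_def outer_def vec_eq_iff mult.assoc
          del: mult_pCons_left)
    then show thesis
      using rank_one_deflation[OF skew Ex p vx False]
        skew_hermitian_pencil_diff[OF skew skew_hermitian_pencil_rank_one[of a b v]]
      by (intro rank_one[OF vec_degree_const_vec[of v]]) (simp_all only:)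
  next
    case True
    define s where "s = dotp (conj_vec cnj v) v"
    have "s \<noteq> 0"
      using v inner_eq_Re_dotp[of v v] by (auto simp: s_def)
    define z where "z = const_vec ((1/s) *s v)"
    have "dotp (conj_vec cnj v) ((1/s) *s v) = (1/s) * s"
      by (simp only: s_def dotp_scale)
    then have z: "dotp (star ?v) z = 1"
      using \<open>s \<noteq> 0\<close> by (simp add: z_def dotp_const_vec one_pCons)
    define w where "w = [:1/2:] *s (dotp (star z) (E *v z) *s ?v) - E *v z"
    have Ez: "degree ((E *v z) $ i) \<le> 1" for i
      unfolding z_def using skew by (intro degree_matrix_mult_const) (simp add: skew_hermitian_pencil_iff)
    have "degree (dotp (star z) (E *v z)) \<le> 1"
      unfolding dotp_def
    proof (intro degree_sum_le)
      fix i
      have "star z $ i * (E *v z) $ i = smult (cnj (((1/s) *s v) $ i)) ((E *v z) $ i)"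
        by (subst (1) z_def) (simp add: conj_vec_def const_vec_def map_poly_pCons)
      then show "degree (star z $ i * (E *v z) $ i) \<le> 1"
        using Ez[of i] by (simp only:) (intro degree_smult_le[THEN order_trans])
    qed simp
    moreover have "w $ i = smult (v $ i / 2) (dotp (star z) (E *v z)) - (E *v z) $ i" for i
      by (simp add: w_def const_vec_def)
    ultimately have "degree (w $ i) \<le> 1" for i
      using Ez[of i] by (simp only:) (intro degree_diff_le degree_smult_le[THEN order_trans])
    then have w: "vec_degree w \<le> 1"
      by (simp add: vec_degree_le_iff)
    have "E - (outer_conj ?v w - outer_conj w ?v) = E - outer_conj ?v w + outer_conj w ?v"
      by simp
    moreover have "normal_rank \<dots> + 2 \<le> normal_rank E"
      using vx True by (intro rank_two_deflation[OF skew Ex p _ z w_def]) simp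
    ultimately have "normal_rank (E - (outer_conj ?v w - outer_conj w ?v)) + 2 \<le> normal_rank E"
      by (simp only:)
    then show thesis
      using skew_hermitian_pencil_diff[OF skew skew_hermitian_pencil_rank_two[OF w]]
      by (intro rank_two[OF vec_degree_const_vec[of v] w]) simp_all
  qed
qed

section \<open>Induction on the normal rank\<close>

lemma skew_hermitian_pencil_decomposes:
  "skew_hermitian_pencil E \<Longrightarrow> \<exists>l s. decomposes E l s \<and> l + 2 * s \<le> normal_rank E"
proof (induction "normal_rank E" arbitrary: E rule: less_induct)
  case less
  show ?case
  proof (cases "E = 0")
    case True
    then show ?thesis
      using decomposes_zero by (intro exI[of _ 0]) simp
  next
    case False
    from less.prems False show ?thesis
    proof (cases rule: skew_hermitian_pencil_reduction)
      case (rank_one a b u F)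
      then obtain l s where ls: "decomposes (E - F) l s" "l + 2 * s \<le> normal_rank (E - F)"
        using less.hyps by blast
      have "decomposes E (Suc l) s"
        using decomposes_add_rank_one[OF ls(1) rank_one(1), of a b] by (simp flip: rank_one(4))
      moreover have "Suc l + 2 * s \<le> normal_rank E"
        using ls(2) rank_one(3) by linarith
      ultimately show ?thesis
        by blast
    next
      case (rank_two v w F)
      then have "normal_rank (E - F) < normal_rank E"
        by linarith
      then obtain l s where ls: "decomposes (E - F) l s" "l + 2 * s \<le> normal_rank (E - F)"
        using less.hyps rank_two(3) by blast
      have "E - F + outer_conj v w - outer_conj w v = E"
        by (simp add: rank_two(5))
      then have "decomposes E l (Suc s)"
        using decomposes_add_rank_two[OF ls(1) rank_two(1,2)] by (simp only:)
      moreover have "l + 2 * Suc s \<le> normal_rank E"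
        using add_mono[OF ls(2) order_refl[of 2]] rank_two(4) by simp
      ultimately show ?thesis
        by blast
    qed
  qed
qed

theorem theorem10:
  fixes E :: "complex poly ^ 'n ^ 'n" and r :: nat
  assumes "skew_hermitian_pencil E"
    and "normal_rank E = r"
    and "r \<le> CARD('n)"
  shows "\<exists>(l::nat) (s::nat) (a :: nat \<Rightarrow> real) (b :: nat \<Rightarrow> real)
      (u :: nat \<Rightarrow> complex poly ^ 'n) (v :: nat \<Rightarrow> complex poly ^ 'n) (w :: nat \<Rightarrow> complex poly ^ 'n).
    E = (\<Sum>i=1..l. poly_scale_matrix [:\<i> * complex_of_real (a i), \<i> * complex_of_real (b i):]
                     (outer_conj (u i) (u i)))
        + (\<Sum>j=1..s. outer_conj (v j) (w j))
        - (\<Sum>j=1..s. outer_conj (w j) (v j)) \<and>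
    l + 2 * s = r \<and>
    (\<forall>i\<in>{1..l}. vec_degree (u i) = 0) \<and>
    (\<forall>j\<in>{1..s}. vec_degree (v j) = 0) \<and>
    (\<forall>j\<in>{1..s}. vec_degree (w j) \<le> 1)"
proof -
  obtain l s where ls: "decomposes E l s" "l + 2 * s \<le> r"
    using skew_hermitian_pencil_decomposes[OF assms(1)] unfolding assms(2) by blast
  then have r: "(r - 2 * s) + 2 * s = r"
    by simp
  have "decomposes E (r - 2 * s) s"
    using decomposes_pad[OF ls(1), of "r - 2 * s - l"] ls(2) by simp
  then obtain a b u v w where
    "E = (\<Sum>i=1..r - 2 * s. poly_scale_matrix [:\<i> * complex_of_real (a i), \<i> * complex_of_real (b i):]
                     (outer_conj (u i) (u i)))
        + (\<Sum>j=1..s. outer_conj (v j) (w j))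
        - (\<Sum>j=1..s. outer_conj (w j) (v j)) \<and>
    (\<forall>i\<in>{1..r - 2 * s}. vec_degree (u i) = 0) \<and>
    (\<forall>j\<in>{1..s}. vec_degree (v j) = 0) \<and>
    (\<forall>j\<in>{1..s}. vec_degree (w j) \<le> 1)"
    unfolding decomposes_def by (elim exE)
  with r show ?thesis
    by (intro exI[of _ "r - 2 * s"] exI[of _ s] exI[of _ a] exI[of _ b] exI[of _ u] exI[of _ v]
        exI[of _ w] conjI) (elim conjE, assumption)+
qed

end
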